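(* There is a universal numerical constant $C>0$ such that for all $n\in\mathbb{N}$, $x\in\mathcal{X}$, $\lambda>0$, $\alpha\in(0,1]$, and $S_1,\dots,S_n$ i.i.d. from $P_0$, $$\mathrm{Var}[\nabla\mathcal{L}_{\mathrm{kl\text{-}CVaR}}(x;S_1^n)]\le C\,\frac{G^2}{\alpha n}\qquad\text{and}\qquad \mathrm{Var}[\nabla\mathcal{L}_{\chi^2\text{-pen}}(x;S_1^n)]\le C\,\frac{G^2(1+B/\lambda)}{n}.$$
   Context: Setting: $\mathcal{X}\subset\mathbb{R}^d$ is closed and convex with diameter at most $R$; $P_0$ is a probability distribution on a sample space $\mathbb{S}$; the loss $\ell:\mathcal{X}\times\mathbb{S}\to[0,B]$ is convex and $G$-Lipschitz in $x$ (Euclidean norm); $\nabla\ell(x;s)$ is a fixed choice of subgradient of $\ell(\cdot;s)$ at $x$. For a sample $s_1^n$ and a convex $\psi:\mathbb{R}_+\to\mathbb{R}\cup\{\infty\}$ put $$\mathcal{L}(x;s_1^n)=\sup_{q\in\Delta^n}\Big\{\sum_{i=1}^n q_i\ell(x;s_i)-\frac{\lambda}{n}\sum_{i=1}^n\psi(nq_i)\Big\},$$ where $\Delta^n$ is the probability simplex. $\mathcal{L}_{\chi^2\text{-pen}}$ is the case $\psi(t)=\frac12(t-1)^2$; $\mathcal{L}_{\mathrm{kl\text{-}CVaR}}$ is the case $\psi(t)=t\log t-t+1$ for $t\in[0,1/\alpha]$ and $\psi(t)=+\infty$ otherwise. The mini-batch gradient is $\nabla\mathcal{L}(x;s_1^n)=\sum_i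 q_i^\star\nabla\ell(x;s_i)$, where $q^\star$ is the (unique) maximizer. For a random vector $V$, $\mathrm{Var}[V]=\mathbb{E}\|V-\mathbb{E}V\|^2$.
   Formalization: At points of X outside its interior, the chosen subgradients are additionally assumed to have norm at most G; without this the claim fails (e.g. X=[0,1], zero loss, x=0, subgradients −K s with s random and K large). *)

theory Defs
  imports "HOL-Probability.Probability"
begin

text \<open>
  The gradient selection \<open>dl x s\<close> is a subgradient of \<open>loss _ s\<close> relative to \<open>X\<close>. At interior
  points Lipschitz continuity bounds its norm by \<open>G\<close>. At any other point of \<open>X\<close> a subgradient plus
  a normal vector of \<open>X\<close> is again a subgradient, so norms are unbounded there; the usual
  convention that subgradients of a \<open>G\<close>-Lipschitz function have norm at most \<open>G\<close> is therefore
  stated explicitly in \<open>dl_boundary\<close>, for those points only.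
\<close>

locale dro_setting = prob_space P0
  for P0 :: "'s measure" +
  fixes X :: "'a::euclidean_space set"
    and R B G :: real
    and loss :: "'a \<Rightarrow> 's \<Rightarrow> real"
    and dl :: "'a \<Rightarrow> 's \<Rightarrow> 'a"
  assumes X_closed: "closed X"
    and X_convex: "convex X"
    and X_diameter: "bounded X" "diameter X \<le> R"
    and loss_range: "\<And>x s. x \<in> X \<Longrightarrow> s \<in> space P0 \<Longrightarrow> loss x s \<in> {0..B}"
    and loss_convex: "\<And>s. s \<in> space P0 \<Longrightarrow> convex_on X (\<lambda>x. loss x s)"
    and loss_lipschitz: "\<And>s. s \<in> space P0 \<Longrightarrow> G-lipschitz_on X (\<lambda>x. loss x s)"
    and loss_measurable: "\<And>x. x \<in> X \<Longrightarrow> (\<lambda>s. loss x s) \<in> borel_measurable P0"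
    and dl_subgradient: "\<And>x y s. x \<in> X \<Longrightarrow> y \<in> X \<Longrightarrow> s \<in> space P0 \<Longrightarrow>
          loss y s \<ge> loss x s + dl x s \<bullet> (y - x)"
    and dl_boundary: "\<And>x s. x \<in> X \<Longrightarrow> x \<notin> interior X \<Longrightarrow> s \<in> space P0 \<Longrightarrow> norm (dl x s) \<le> G"
    and dl_measurable: "\<And>x. x \<in> X \<Longrightarrow> (\<lambda>s. dl x s) \<in> borel_measurable P0"

text \<open>Weights are set to \<open>0\<close> outside \<open>{..<n}\<close> so that maximizers over the simplex can be unique.\<close>

definition prob_simplex :: "nat \<Rightarrow> (nat \<Rightarrow> real) set" where
  "prob_simplex n = {q. (\<forall>i<n. 0 \<le> q i) \<and> (\<forall>i\<ge>n. q i = 0) \<and> (\<Sum>i<n. q i) = 1}"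

definition penalized_value ::
  "(real \<Rightarrow> ereal) \<Rightarrow> real \<Rightarrow> nat \<Rightarrow> (nat \<Rightarrow> real) \<Rightarrow> (nat \<Rightarrow> real) \<Rightarrow> ereal" where
  "penalized_value \<psi> lam n z q =
     ereal (\<Sum>i<n. q i * z i) - ereal (lam / real n) * (\<Sum>i<n. \<psi> (real n * q i))"

definition robust_loss ::
  "(real \<Rightarrow> ereal) \<Rightarrow> real \<Rightarrow> nat \<Rightarrow> ('a \<Rightarrow> 's \<Rightarrow> real) \<Rightarrow> 'a \<Rightarrow> (nat \<Rightarrow> 's) \<Rightarrow> ereal" where
  "robust_loss \<psi> lam n loss x s =
     (SUP q \<in> prob_simplex n. penalized_value \<psi> lam n (\<lambda>i. loss x (s i)) q)"

definition worst_weights ::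
  "(real \<Rightarrow> ereal) \<Rightarrow> real \<Rightarrow> nat \<Rightarrow> ('a \<Rightarrow> 's \<Rightarrow> real) \<Rightarrow> 'a \<Rightarrow> (nat \<Rightarrow> 's) \<Rightarrow> nat \<Rightarrow> real" where
  "worst_weights \<psi> lam n loss x s =
     (THE q. q \<in> prob_simplex n \<and>
        penalized_value \<psi> lam n (\<lambda>i. loss x (s i)) q = robust_loss \<psi> lam n loss x s)"

definition batch_gradient ::
  "(real \<Rightarrow> ereal) \<Rightarrow> real \<Rightarrow> nat \<Rightarrow> ('a \<Rightarrow> 's \<Rightarrow> real) \<Rightarrow> ('a \<Rightarrow> 's \<Rightarrow> 'a) \<Rightarrow>
     'a \<Rightarrow> (nat \<Rightarrow> 's) \<Rightarrow> 'a::real_vector" where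
  "batch_gradient \<psi> lam n loss dl x s =
     (\<Sum>i<n. worst_weights \<psi> lam n loss x s i *\<^sub>R dl x (s i))"

definition psi_chi2 :: "real \<Rightarrow> ereal" where
  "psi_chi2 t = ereal ((t - 1)\<^sup>2 / 2)"

text \<open>The convention \<open>0 log 0 = 0\<close> holds because \<open>0 * ln 0 = 0\<close>.\<close>

definition psi_klcvar :: "real \<Rightarrow> real \<Rightarrow> ereal" where
  "psi_klcvar \<alpha> t = (if 0 \<le> t \<and> t \<le> 1 / \<alpha> then ereal (t * ln t - t + 1) else \<infinity>)"

definition vec_variance :: "'w measure \<Rightarrow> ('w \<Rightarrow> 'a::euclidean_space) \<Rightarrow> real" where
  "vec_variance M V = (\<integral>\<omega>. (norm (V \<omega> - (\<integral>\<omega>'. V \<omega>' \<partial>M)))\<^sup>2 \<partial>M)"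

definition iid_sample :: "'w measure \<Rightarrow> 's measure \<Rightarrow> nat \<Rightarrow> (nat \<Rightarrow> 'w \<Rightarrow> 's) \<Rightarrow> bool" where
  "iid_sample M P0 n S \<longleftrightarrow>
     prob_space M \<and> prob_space.indep_vars M (\<lambda>_. P0) S {..<n} \<and> (\<forall>i<n. distr M P0 (S i) = P0)"

text \<open>
  A quantifier inside a formula cannot range over types, so in a bare \<open>\<exists>C. \<dots>\<close> the constant could
  depend on the types of the decision space (hence on the dimension), of the sample space and of
  the underlying probability space. A numerical bound on \<open>C\<close>, such as \<open>C \<le> 100\<close>, makes it
  uniform over all of these: by monotonicity in \<open>C\<close>, the one value \<open>100\<close> then serves at every type.
\<close>

end

theory Submission
  imports Defs "HOL-Real_Asymp.Real_Asymp"
begin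

text \<open>
  The gradient estimator is a function of \<open>n\<close> independent samples, so by the Efron--Stein inequality
  (\<open>variance_tensorization\<close>) its variance is at most the sum over \<open>i\<close> of the mean square change caused
  by redrawing sample \<open>i\<close>.

  Redrawing sample \<open>i\<close> changes the loss vector in one coordinate only. Strict convexity of the penalty
  forces the worst-case weights of all other samples to move in one common direction
  (\<open>no_opposite_moves\<close>): otherwise two of them could exchange mass with profit. As the weights sum
  to one, the other weights move by exactly \<open>\<bar>q i - q' i\<bar>\<close> in total
  (\<open>total_change_of_other_weights\<close>). Since subgradients are bounded by \<open>G\<close>, the estimator moves by at
  most \<open>2 * G * max (q i) (q' i)\<close>. Redrawing preserves the distribution, so the variance is at most
  \<open>8 * G\<^sup>2\<close> times a bound for \<open>\<Sum>i<n. (q i)\<^sup>2\<close> (\<open>variance_batch_gradient_le\<close>).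

  The two penalties differ only in how they bound this sum. For KL-CVaR every weight is at most
  \<open>1 / (\<alpha> * n)\<close> and the weights sum to one, so the sum is at most \<open>1 / (\<alpha> * n)\<close>. For the chi-square
  penalty, comparison of the maximizer with uniform weights shows that the penalty paid is at most
  \<open>B\<close>, which means that the sum is at most \<open>(1 + 2 * B / lam) / n\<close> (\<open>sum_squares_chi2_le\<close>).

  The integrals make sense because the worst-case weights depend continuously on the losses
  (\<open>continuous_weights\<close>) and the estimator is therefore a measurable function of the samples.
\<close>

section \<open>Variance of vector-valued functions on product spaces\<close>

lemma vec_variance_nonneg: "0 \<le> vec_variance M f"
  unfolding vec_variance_def by simp

text \<open>
  The bias-variance decomposition. Taking \<open>a = 0\<close> gives the second-moment formula for the variance,
  and dropping the last term shows that the mean is the best constant approximation. For all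
  functions here a uniform bound \<open>c\<close> is at hand, and it settles every integrability question.
\<close>

lemma (in prob_space) integral_norm_diff_sq:
  fixes f :: "'a \<Rightarrow> 'b::euclidean_space"
  assumes [measurable]: "f \<in> borel_measurable M" and c: "\<And>x. x \<in> space M \<Longrightarrow> norm (f x) \<le> c"
  shows "(\<integral>x. (norm (f x - a))\<^sup>2 \<partial>M) = vec_variance M f + (norm (expectation f - a))\<^sup>2"
proof -
  have I: "integrable M f" using c by (intro integrable_const_bound[of _ c]) auto
  define m where "m = expectation f"
  have "integrable M (\<lambda>x. (norm (f x - m))\<^sup>2)"
  proof (intro integrable_const_bound[of _ "(c + norm m)\<^sup>2"] AE_I2)
    fix x assume "x \<in> space M"
    then have "norm (f x - m) \<le> c + norm m" using c[of x] norm_triangle_ineq4[of "f x" m] by linarith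
    then show "norm ((norm (f x - m))\<^sup>2) \<le> (c + norm m)\<^sup>2" by (simp add: power_mono)
  qed simp
  note [simp] = I this
  have "(\<integral>x. (norm (f x - a))\<^sup>2 \<partial>M)
      = (\<integral>x. (norm (f x - m))\<^sup>2 + 2 * ((f x - m) \<bullet> (m - a)) + (norm (m - a))\<^sup>2 \<partial>M)"
    by (rule arg_cong2[where f="integral\<^sup>L"])
       (auto simp: power2_norm_eq_inner inner_simps inner_commute algebra_simps)
  also have "\<dots> = (\<integral>x. (norm (f x - m))\<^sup>2 \<partial>M) + 2 * ((m - m) \<bullet> (m - a)) + (norm (m - a))\<^sup>2"
  proof -
    have "(\<integral>x. (norm (f x - m))\<^sup>2 + 2 * ((f x - m) \<bullet> (m - a)) + (norm (m - a))\<^sup>2 \<partial>M)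
        = (\<integral>x. (norm (f x - m))\<^sup>2 \<partial>M) + (\<integral>x. 2 * ((f x - m) \<bullet> (m - a)) \<partial>M) + (norm (m - a))\<^sup>2"
      by (simp add: prob_space)
    also have "(\<integral>x. 2 * ((f x - m) \<bullet> (m - a)) \<partial>M) = 2 * ((\<integral>x. f x - m \<partial>M) \<bullet> (m - a))"
      by (simp del: Bochner_Integration.integral_diff)
    also have "(\<integral>x. f x - m \<partial>M) = m - m" by (simp add: prob_space m_def)
    finally show ?thesis .
  qed
  finally show ?thesis by (simp add: vec_variance_def m_def)
qed

lemma (in prob_space) vec_variance_eq:
  fixes f :: "'a \<Rightarrow> 'b::euclidean_space"
  assumes "f \<in> borel_measurable M" and "\<And>x. x \<in> space M \<Longrightarrow> norm (f x) \<le> c"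
  shows "vec_variance M f = (\<integral>x. (norm (f x))\<^sup>2 \<partial>M) - (norm (expectation f))\<^sup>2"
  using integral_norm_diff_sq[OF assms, of 0] by simp

lemma (in prob_space) vec_variance_le:
  fixes f :: "'a \<Rightarrow> 'b::euclidean_space"
  assumes "f \<in> borel_measurable M" and "\<And>x. x \<in> space M \<Longrightarrow> norm (f x) \<le> c"
  shows "vec_variance M f \<le> (\<integral>x. (norm (f x - a))\<^sup>2 \<partial>M)"
  using integral_norm_diff_sq[OF assms, of a] by simp

lemma (in prob_space) vec_variance_le_bound:
  fixes f :: "'a \<Rightarrow> 'b::euclidean_space"
  assumes [measurable]: "f \<in> borel_measurable M" and c: "\<And>x. x \<in> space M \<Longrightarrow> norm (f x) \<le> c"
  shows "vec_variance M f \<le> c\<^sup>2"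
proof -
  have "vec_variance M f \<le> (\<integral>x. (norm (f x))\<^sup>2 \<partial>M)"
    using vec_variance_le[OF assms, of 0] by simp
  also have "\<dots> \<le> (\<integral>x. c\<^sup>2 \<partial>M)"
    using c by (intro integral_mono_AE' AE_I2) (auto intro: power_mono)
  finally show ?thesis by (simp add: prob_space)
qed

lemma vec_variance_distr:
  fixes f :: "'b \<Rightarrow> 'c::euclidean_space"
  assumes "g \<in> measurable M N" "f \<in> borel_measurable N"
  shows "vec_variance (distr M N g) f = vec_variance M (\<lambda>x. f (g x))"
  using assms by (simp add: vec_variance_def integral_distr)

text \<open>
  Write \<open>A y\<close> for the mean of \<open>g\<close> over \<open>x\<close> and \<open>m x\<close> for its mean over \<open>y\<close>. The law of total variance
  splits the variance of \<open>g\<close> into the mean of the variances in \<open>x\<close>, which is the first summand, and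
  the variance of \<open>A\<close>. The deviation of \<open>A\<close> from its mean is the average over \<open>x\<close> of \<open>g x y - m x\<close>, so
  Jensen's inequality bounds the variance of \<open>A\<close> by the second summand.
\<close>

lemma vec_variance_pair_le:
  fixes g :: "'a \<Rightarrow> 'b \<Rightarrow> 'c::euclidean_space"
  assumes "prob_space N" "prob_space K"
    and [measurable]: "case_prod g \<in> borel_measurable (N \<Otimes>\<^sub>M K)"
    and c: "\<And>x y. x \<in> space N \<Longrightarrow> y \<in> space K \<Longrightarrow> norm (g x y) \<le> c"
  shows "vec_variance (N \<Otimes>\<^sub>M K) (case_prod g)
    \<le> (\<integral>y. vec_variance N (\<lambda>x. g x y) \<partial>K) + (\<integral>x. vec_variance K (g x) \<partial>N)"
proof -
  interpret N: prob_space N by fact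
  interpret K: prob_space K by fact
  interpret NK: pair_prob_space N K ..
  have sections[measurable]: "\<And>x. x \<in> space N \<Longrightarrow> g x \<in> borel_measurable K"
    "\<And>y. y \<in> space K \<Longrightarrow> (\<lambda>x. g x y) \<in> borel_measurable N"
    using measurable_Pair2[OF assms(3)] measurable_Pair1[OF assms(3)] by auto
  have swapm[measurable]: "(\<lambda>(y, x). g x y) \<in> borel_measurable (K \<Otimes>\<^sub>M N)"
    using measurable_pair_swap[OF assms(3)] by (simp add: case_prod_beta')
  have c0: "0 \<le> c"
    using N.not_empty K.not_empty c norm_ge_zero by (meson all_not_in_conv order_trans)
  define A where "A y = (\<integral>x. g x y \<partial>N)" for y
  define m where "m x = (\<integral>y. g x y \<partial>K)" for x
  have [measurable]: "A \<in> borel_measurable K" "m \<in> borel_measurable N"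
    unfolding A_def m_def by measurable
  have A: "norm (A y) \<le> c" if "y \<in> space K" for y
    unfolding A_def using that c c0
    by (intro order_trans[OF integral_norm_bound] N.integral_le_const
              N.integrable_const_bound[of _ c] AE_I2) auto
  have m: "norm (m x) \<le> c" if "x \<in> space N" for x
    unfolding m_def using that c c0
    by (intro order_trans[OF integral_norm_bound] K.integral_le_const
              K.integrable_const_bound[of _ c] AE_I2) auto
  have Ig: "integrable (N \<Otimes>\<^sub>M K) (case_prod g)"
    by (intro NK.integrable_const_bound[of _ c] AE_I2) (auto simp: space_pair_measure c)
  have Ig2: "integrable (N \<Otimes>\<^sub>M K) (case_prod (\<lambda>x y. (norm (g x y))\<^sup>2))"
    by (intro NK.integrable_const_bound[of _ "c\<^sup>2"] AE_I2)
       (auto simp: space_pair_measure intro!: power_mono c)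
  have d: "(norm (g x y - m x))\<^sup>2 \<le> (2 * c)\<^sup>2" if "x \<in> space N" "y \<in> space K" for x y
    using c[OF that] m[OF that(1)] norm_triangle_ineq4[of "g x y" "m x"] c0
    by (intro power_mono) auto
  have Id: "integrable (N \<Otimes>\<^sub>M K) (case_prod (\<lambda>x y. (norm (g x y - m x))\<^sup>2))"
    using d by (intro NK.integrable_const_bound[of _ "(2 * c)\<^sup>2"] AE_I2)
       (auto simp: space_pair_measure)
  have EA: "(\<integral>y. A y \<partial>K) = (\<integral>x. m x \<partial>N)"
    unfolding A_def m_def using NK.Fubini_integral[OF Ig] by simp
  have [simp]: "integrable K (\<lambda>y. (norm (A y))\<^sup>2)"
    using A by (intro K.integrable_const_bound[of _ "c\<^sup>2"] AE_I2) (auto intro: power_mono)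
  have [simp]: "integrable K (\<lambda>y. \<integral>x. (norm (g x y))\<^sup>2 \<partial>N)"
    using NK.integrable_snd[OF Ig2] by simp
  have "vec_variance (N \<Otimes>\<^sub>M K) (case_prod g)
      = (\<integral>z. (norm (case_prod g z))\<^sup>2 \<partial>(N \<Otimes>\<^sub>M K)) - (norm (\<integral>z. case_prod g z \<partial>(N \<Otimes>\<^sub>M K)))\<^sup>2"
    by (rule NK.vec_variance_eq[of _ c]) (auto simp: space_pair_measure c)
  also have "(\<integral>z. case_prod g z \<partial>(N \<Otimes>\<^sub>M K)) = (\<integral>y. A y \<partial>K)"
    unfolding A_def using NK.integral_snd[OF Ig] by simp
  also have "(\<integral>z. (norm (case_prod g z))\<^sup>2 \<partial>(N \<Otimes>\<^sub>M K)) = (\<integral>y. \<integral>x. (norm (g x y))\<^sup>2 \<partial>N \<partial>K)"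
    using NK.integral_snd[OF Ig2] by (simp add: case_prod_beta')
  also have "(\<integral>y. \<integral>x. (norm (g x y))\<^sup>2 \<partial>N \<partial>K) - (norm (\<integral>y. A y \<partial>K))\<^sup>2
    = (\<integral>y. (\<integral>x. (norm (g x y))\<^sup>2 \<partial>N) - (norm (A y))\<^sup>2 \<partial>K) + vec_variance K A"
    using K.vec_variance_eq[of A c] A by simp
  also have "(\<integral>y. (\<integral>x. (norm (g x y))\<^sup>2 \<partial>N) - (norm (A y))\<^sup>2 \<partial>K)
    = (\<integral>y. vec_variance N (\<lambda>x. g x y) \<partial>K)"
    by (intro Bochner_Integration.integral_cong refl)
       (use c in \<open>simp add: N.vec_variance_eq[of _ c] A_def\<close>)
  also have "vec_variance K A \<le> (\<integral>y. \<integral>x. (norm (g x y - m x))\<^sup>2 \<partial>N \<partial>K)"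
    unfolding vec_variance_def
  proof (intro integral_mono_AE' AE_I2)
    show "integrable K (\<lambda>y. \<integral>x. (norm (g x y - m x))\<^sup>2 \<partial>N)"
      using NK.integrable_snd[OF Id] by simp
    fix y assume y[measurable]: "y \<in> space K"
    have b: "norm (g x y - m x) \<le> 2 * c" if "x \<in> space N" for x
      using c[OF that y] m[OF that] norm_triangle_ineq4[of "g x y" "m x"] by auto
    \<comment> \<open>Jensen enters as non-negativity of the variance of \<open>\<lambda>x. g x y - m x\<close>.\<close>
    have "A y - (\<integral>y. A y \<partial>K) = (\<integral>x. g x y - m x \<partial>N)"
      unfolding EA unfolding A_def
      using c y m by (subst Bochner_Integration.integral_diff)
         (auto intro!: N.integrable_const_bound[of _ c] AE_I2)
    then show "(norm (A y - (\<integral>y. A y \<partial>K)))\<^sup>2 \<le> (\<integral>x. (norm (g x y - m x))\<^sup>2 \<partial>N)"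
      using N.vec_variance_eq[of "\<lambda>x. g x y - m x" "2 * c"] b
        vec_variance_nonneg[of N "\<lambda>x. g x y - m x"] by simp
  qed simp
  also have "(\<integral>y. \<integral>x. (norm (g x y - m x))\<^sup>2 \<partial>N \<partial>K) = (\<integral>x. vec_variance K (g x) \<partial>N)"
    unfolding vec_variance_def using NK.Fubini_integral[OF Id] by (simp add: m_def)
  finally show ?thesis by simp
qed

lemma measurable_resample:
  assumes "j \<in> I"
  shows "(\<lambda>(s, t). s(j := t)) \<in> measurable (PiM I M \<Otimes>\<^sub>M M j) (PiM I M)"
  using measurable_add_dim[of j I M] assms by (simp add: insert_absorb)

text \<open>
  The index \<open>i\<close> may already belong to \<open>I\<close>; in that case the map replaces a coordinate by an
  independent copy, and the identity says that this leaves the distribution unchanged.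
\<close>

lemma PiM_insert_eq_distr:
  assumes "\<And>i. prob_space (M i)"
  shows "PiM (insert i I) M = distr (PiM I M \<Otimes>\<^sub>M M i) (PiM (insert i I) M) (\<lambda>(x, y). x(i := y))"
proof -
  interpret N: prob_space "PiM I M" by (intro prob_space_PiM assms)
  interpret K: prob_space "M i" by (rule assms)
  interpret NK: pair_sigma_finite "PiM I M" "M i" ..
  have "PiM (insert i I) M
      = distr (M i \<Otimes>\<^sub>M PiM I M) (PiM (insert i I) M) (\<lambda>(y, x). x(i := y))"
    by (rule distr_pair_PiM_eq_PiM[symmetric]) (auto intro: assms)
  also have "M i \<Otimes>\<^sub>M PiM I M
      = distr (PiM I M \<Otimes>\<^sub>M M i) (M i \<Otimes>\<^sub>M PiM I M) (\<lambda>(x, y). (y, x))"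
    by (metis pair_sigma_finite.distr_pair_swap pair_sigma_finite.intro
        K.sigma_finite_measure_axioms N.sigma_finite_measure_axioms)
  finally show ?thesis
    by (subst (asm) distr_distr) (auto simp: comp_def case_prod_beta')
qed

text \<open>
  The Efron--Stein inequality: induction on the index set, peeling off one coordinate with
  \<open>vec_variance_pair_le\<close>. The induction hypothesis is applied for each fixed value of the
  coordinate that was split off, and Fubini's theorem puts that coordinate back.
\<close>

lemma variance_tensorization:
  fixes f :: "('i \<Rightarrow> 's) \<Rightarrow> 'a::euclidean_space"
  assumes M: "\<And>i. prob_space (M i)" and "finite I"
    and "f \<in> borel_measurable (PiM I M)"
    and "\<And>s. s \<in> space (PiM I M) \<Longrightarrow> norm (f s) \<le> c"
  shows "vec_variance (PiM I M) f
    \<le> (\<Sum>j\<in>I. \<integral>s. vec_variance (M j) (\<lambda>t. f (s(j := t))) \<partial>PiM I M)"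
  using assms(2-)
proof (induction I arbitrary: f rule: finite_induct)
  case empty
  interpret prob_space "PiM {} M" by (intro prob_space_PiM M)
  have "vec_variance (PiM {} M) f \<le> (\<integral>s. (norm (f s - f (\<lambda>_. undefined)))\<^sup>2 \<partial>PiM {} M)"
    using vec_variance_le[OF empty.prems] by simp
  also have "\<dots> = (\<integral>s. 0 \<partial>PiM {} M)"
    by (intro Bochner_Integration.integral_cong) (auto simp: space_PiM_empty)
  finally show ?case by simp
next
  case (insert i I)
  note [measurable] = insert.prems(1)
  let ?P = "PiM (insert i I) M"
  interpret N: prob_space "PiM I M" by (intro prob_space_PiM M)
  interpret K: prob_space "M i" by (rule M)
  interpret P: prob_space ?P by (intro prob_space_PiM M)
  interpret NK: pair_prob_space "PiM I M" "M i" ..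
  interpret product_sigma_finite M
    by (simp add: product_sigma_finite_def M prob_space_imp_sigma_finite)
  have upd[measurable]: "(\<lambda>(x, y). x(i := y)) \<in> measurable (PiM I M \<Otimes>\<^sub>M M i) ?P"
    by (rule measurable_add_dim)
  have upd_space: "x(i := y) \<in> space ?P" if "x \<in> space (PiM I M)" "y \<in> space (M i)" for x y
    using measurable_space[OF upd, of "(x, y)"] that by (simp add: space_pair_measure)
  have res_space: "s(j := t) \<in> space ?P"
    if "s \<in> space ?P" "j \<in> insert i I" "t \<in> space (M j)" for s j t
    using measurable_space[OF measurable_resample[of j "insert i I" M], of "(s, t)"] that
    by (simp add: space_pair_measure)
  define v where "v j s = vec_variance (M j) (\<lambda>t. f (s(j := t)))" for j s
  have v_meas[measurable]: "v j \<in> borel_measurable ?P" if "j \<in> insert i I" for j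
  proof -
    interpret Mj: prob_space "M j" by (rule M)
    have [measurable]: "(\<lambda>(s, t). f (s(j := t))) \<in> borel_measurable (?P \<Otimes>\<^sub>M M j)"
      using measurable_compose[OF measurable_resample[OF that] insert.prems(1)]
      by (simp add: case_prod_beta' fun_upd_def)
    show ?thesis unfolding v_def vec_variance_def by measurable
  qed
  have v_le: "v j s \<le> c\<^sup>2" if "j \<in> insert i I" "s \<in> space ?P" for j s
  proof -
    interpret Mj: prob_space "M j" by (rule M)
    have [measurable]: "(\<lambda>t. f (s(j := t))) \<in> borel_measurable (M j)"
      using measurable_Pair2[OF measurable_resample[OF that(1)] that(2)] insert.prems(1)
      by (auto intro: measurable_compose)
    show ?thesis unfolding v_def
      by (intro Mj.vec_variance_le_bound) (use that res_space insert.prems(2) in auto)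
  qed
  have v_int: "integrable ?P (v j)" if "j \<in> insert i I" for j
    using v_le[OF that] v_meas[OF that]
    by (intro P.integrable_const_bound[of _ "c\<^sup>2"] AE_I2) (auto simp: v_def vec_variance_nonneg)
  have v_split: "integrable (PiM I M \<Otimes>\<^sub>M M i) (\<lambda>(x, y). v j (x(i := y)))" if "j \<in> insert i I" for j
    using v_le[OF that] measurable_compose[OF upd v_meas[OF that]]
    by (intro NK.integrable_const_bound[of _ "c\<^sup>2"] AE_I2)
       (auto simp: v_def vec_variance_nonneg space_pair_measure upd_space case_prod_beta')
  have "vec_variance ?P f = vec_variance (PiM I M \<Otimes>\<^sub>M M i) (\<lambda>(x, y). f (x(i := y)))"
    by (subst PiM_insert_eq_distr[OF M], subst vec_variance_distr) (auto simp: case_prod_beta')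
  also have "\<dots> \<le> (\<integral>y. vec_variance (PiM I M) (\<lambda>x. f (x(i := y))) \<partial>M i)
      + (\<integral>x. vec_variance (M i) (\<lambda>y. f (x(i := y))) \<partial>PiM I M)"
    by (intro vec_variance_pair_le[of _ _ _ c] N.prob_space_axioms K.prob_space_axioms
              insert.prems(2) upd_space) auto
  also have "(\<integral>x. vec_variance (M i) (\<lambda>y. f (x(i := y))) \<partial>PiM I M) = (\<integral>s. v i s \<partial>?P)"
    by (subst product_integral_insert[OF insert.hyps v_int]) (auto simp: v_def K.prob_space)
  also have "(\<integral>y. vec_variance (PiM I M) (\<lambda>x. f (x(i := y))) \<partial>M i)
      \<le> (\<integral>y. (\<Sum>j\<in>I. \<integral>x. v j (x(i := y)) \<partial>PiM I M) \<partial>M i)"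
  proof (intro integral_mono_AE' AE_I2)
    show "integrable (M i) (\<lambda>y. \<Sum>j\<in>I. \<integral>x. v j (x(i := y)) \<partial>PiM I M)"
      using NK.integrable_snd[OF v_split] by (intro Bochner_Integration.integrable_sum) auto
    fix y assume y: "y \<in> space (M i)"
    have m: "(\<lambda>x. f (x(i := y))) \<in> borel_measurable (PiM I M)"
      using measurable_compose[OF measurable_Pair1[OF upd y] insert.prems(1)]
      by (simp add: fun_upd_def)
    have "vec_variance (PiM I M) (\<lambda>x. f (x(i := y)))
        \<le> (\<Sum>j\<in>I. \<integral>x. vec_variance (M j) (\<lambda>t. f (x(j := t, i := y))) \<partial>PiM I M)"
      by (rule insert.IH[OF m]) (intro insert.prems(2) upd_space y)
    also have "\<dots> = (\<Sum>j\<in>I. \<integral>x. v j (x(i := y)) \<partial>PiM I M)"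
    proof (intro sum.cong refl Bochner_Integration.integral_cong)
      fix j x assume "j \<in> I"
      then have "j \<noteq> i" using insert.hyps by auto
      then show "vec_variance (M j) (\<lambda>t. f (x(j := t, i := y))) = v j (x(i := y))"
        unfolding v_def by (subst fun_upd_twist) auto
    qed
    finally show "vec_variance (PiM I M) (\<lambda>x. f (x(i := y)))
        \<le> (\<Sum>j\<in>I. \<integral>x. v j (x(i := y)) \<partial>PiM I M)" .
  qed (auto simp: v_def vec_variance_nonneg intro!: sum_nonneg Bochner_Integration.integral_nonneg)
  also have "(\<integral>y. (\<Sum>j\<in>I. \<integral>x. v j (x(i := y)) \<partial>PiM I M) \<partial>M i) = (\<Sum>j\<in>I. \<integral>s. v j s \<partial>?P)"
  proof (subst Bochner_Integration.integral_sum)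
    show "integrable (M i) (\<lambda>y. \<integral>x. v j (x(i := y)) \<partial>PiM I M)" if "j \<in> I" for j
      using NK.integrable_snd[OF v_split] that by auto
    show "(\<Sum>j\<in>I. \<integral>y. \<integral>x. v j (x(i := y)) \<partial>PiM I M \<partial>M i) = (\<Sum>j\<in>I. \<integral>s. v j s \<partial>?P)"
      using NK.Fubini_integral[OF v_split] product_integral_insert[OF insert.hyps v_int]
      by (intro sum.cong) auto
  qed
  finally show ?case
    using insert.hyps by (simp add: v_def add.commute del: fun_upd_apply)
qed

lemma integral_resample:
  fixes h :: "('i \<Rightarrow> 's) \<Rightarrow> real"
  assumes M: "\<And>i. prob_space (M i)" and "j \<in> I" and h: "integrable (PiM I M) h"
  shows "integrable (PiM I M \<Otimes>\<^sub>M M j) (\<lambda>(s, t). h (s(j := t)))"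
    and "(\<integral>s. \<integral>t. h (s(j := t)) \<partial>M j \<partial>PiM I M) = (\<integral>s. h s \<partial>PiM I M)"
proof -
  interpret P: prob_space "PiM I M" by (intro prob_space_PiM M)
  interpret K: prob_space "M j" by (rule M)
  interpret NK: pair_prob_space "PiM I M" "M j" ..
  note [measurable] = measurable_resample[OF \<open>j \<in> I\<close>] borel_measurable_integrable[OF h]
  have eq: "distr (PiM I M \<Otimes>\<^sub>M M j) (PiM I M) (\<lambda>(x, y). x(j := y)) = PiM I M"
    using PiM_insert_eq_distr[where M = M and i = j and I = I, OF M] \<open>j \<in> I\<close> by (simp add: insert_absorb)
  have "integrable (distr (PiM I M \<Otimes>\<^sub>M M j) (PiM I M) (\<lambda>(x, y). x(j := y))) h"
    unfolding eq by (rule h)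
  then show *: "integrable (PiM I M \<Otimes>\<^sub>M M j) (\<lambda>(s, t). h (s(j := t)))"
    by (simp add: integrable_distr_eq case_prod_beta')
  have "(\<integral>s. h s \<partial>PiM I M)
      = (\<integral>s. h s \<partial>distr (PiM I M \<Otimes>\<^sub>M M j) (PiM I M) (\<lambda>(x, y). x(j := y)))"
    unfolding eq ..
  also have "\<dots> = (\<integral>z. (case z of (s, t) \<Rightarrow> h (s(j := t))) \<partial>(PiM I M \<Otimes>\<^sub>M M j))"
    by (simp add: integral_distr case_prod_beta')
  also have "\<dots> = (\<integral>s. \<integral>t. h (s(j := t)) \<partial>M j \<partial>PiM I M)"
    using NK.integral_fst[OF *] by simp
  finally show "(\<integral>s. \<integral>t. h (s(j := t)) \<partial>M j \<partial>PiM I M) = (\<integral>s. h s \<partial>PiM I M)" ..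
qed

section \<open>Worst-case weights under a strictly convex penalty\<close>

text \<open>
  By the mean value theorem the increments of \<open>\<phi>\<close> over \<open>{a..a + e}\<close> and \<open>{b - e..b}\<close> are \<open>e\<close> times a
  derivative, taken further to the right for the second interval. At the endpoints continuity
  replaces differentiability, because \<open>t * ln t\<close> has no derivative at \<open>0\<close>.
\<close>

lemma exchange_of_increasing_derivative:
  fixes \<phi> D :: "real \<Rightarrow> real"
  assumes cont: "continuous_on {0..T} \<phi>"
    and deriv: "\<And>t. 0 < t \<Longrightarrow> t < T \<Longrightarrow> (\<phi> has_real_derivative D t) (at t)"
    and mono: "\<And>s t. 0 < s \<Longrightarrow> s < t \<Longrightarrow> D s < D t"
    and ab: "0 \<le> a" "0 < e" "a + e \<le> b - e" "b \<le> T"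
  shows "\<phi> (a + e) + \<phi> (b - e) < \<phi> a + \<phi> b"
proof -
  have mvt: "\<exists>l z. u < z \<and> z < v \<and> (\<phi> has_real_derivative l) (at z) \<and> \<phi> v - \<phi> u = (v - u) * l"
    if "0 \<le> u" "u < v" "v \<le> T" for u v
  proof (rule MVT[OF \<open>u < v\<close>])
    show "continuous_on {u..v} \<phi>" using cont by (rule continuous_on_subset) (use that in auto)
    show "\<phi> differentiable at t" if "u < t" "t < v" for t
      using deriv[of t] that \<open>0 \<le> u\<close> \<open>v \<le> T\<close> by (auto simp: real_differentiable_def)
  qed
  obtain l z where z: "a < z" "z < a + e" "(\<phi> has_real_derivative l) (at z)"
    "\<phi> (a + e) - \<phi> a = e * l" using mvt[of a "a + e"] ab by auto
  obtain l' z' where z': "b - e < z'" "z' < b" "(\<phi> has_real_derivative l') (at z')"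
    "\<phi> b - \<phi> (b - e) = e * l'" using mvt[of "b - e" b] ab by auto
  have "l = D z" using z ab by (intro DERIV_unique[OF z(3) deriv]) auto
  moreover have "l' = D z'" using z' ab by (intro DERIV_unique[OF z'(3) deriv]) auto
  ultimately have "l < l'" using mono[of z z'] z z' ab by auto
  then have "e * l < e * l'" using ab by simp
  then show ?thesis using z(4) z'(4) by linarith
qed

lemma sum_fun_upd_two:
  fixes h :: "'i \<Rightarrow> 'b \<Rightarrow> 'c::ab_group_add"
  assumes "finite A" "j \<in> A" "k \<in> A" "j \<noteq> k"
  shows "(\<Sum>i\<in>A. h i ((q(j := a, k := b)) i))
    = (\<Sum>i\<in>A. h i (q i)) + (h j a - h j (q j)) + (h k b - h k (q k))"
proof -
  have A: "A = insert j (insert k (A - {j, k}))" using assms by auto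
  have "(\<Sum>i\<in>A - {j, k}. h i ((q(j := a, k := b)) i)) = (\<Sum>i\<in>A - {j, k}. h i (q i))"
    by (intro sum.cong) auto
  then show ?thesis
    using assms by (subst (1 2) A) (simp add: algebra_simps)
qed

lemma exists_less_if_sum_eq:
  fixes q q' :: "'i \<Rightarrow> real"
  assumes "finite A" "sum q A = sum q' A" "j \<in> A" "q j < q' j"
  shows "\<exists>k\<in>A. q' k < q k"
proof (rule ccontr)
  assume "\<not> ?thesis"
  then have "sum q A < sum q' A" using assms by (intro sum_strict_mono_ex1) force+
  then show False using assms by simp
qed

text \<open>
  Both penalties of interest are a finite strictly convex function \<open>\<phi>\<close> up to a cap \<open>T\<close> on \<open>n * q i\<close>
  and infinite beyond it. For KL-CVaR the cap is \<open>1 / \<alpha>\<close>; for the chi-square penalty it is \<open>n\<close>, which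
  every point of the simplex respects. Strict convexity is stated as the exchange inequality because
  all arguments below move mass between two coordinates.
\<close>

locale weight_penalty =
  fixes \<psi> :: "real \<Rightarrow> ereal" and \<phi> :: "real \<Rightarrow> real" and T lam :: real and n :: nat
  assumes psi: "\<And>t. 0 \<le> t \<Longrightarrow> t \<le> real n \<Longrightarrow> \<psi> t = (if t \<le> T then ereal (\<phi> t) else \<infinity>)"
    and T: "1 \<le> T" and n: "1 \<le> n" and lam: "0 < lam"
    and cont: "continuous_on {0..T} \<phi>"
    and exchange: "\<And>a b e. 0 \<le> a \<Longrightarrow> 0 < e \<Longrightarrow> a + e \<le> b - e \<Longrightarrow> b \<le> T
      \<Longrightarrow> \<phi> (a + e) + \<phi> (b - e) < \<phi> a + \<phi> b"
begin

definition feasible :: "(nat \<Rightarrow> real) set" where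
  "feasible = {q \<in> prob_simplex n. \<forall>i<n. real n * q i \<le> T}"

definition objective :: "(nat \<Rightarrow> real) \<Rightarrow> (nat \<Rightarrow> real) \<Rightarrow> real" where
  "objective z q = (\<Sum>i<n. q i * z i) - lam / real n * (\<Sum>i<n. \<phi> (real n * q i))"

definition maximal :: "(nat \<Rightarrow> real) \<Rightarrow> (nat \<Rightarrow> real) \<Rightarrow> bool" where
  "maximal z q \<longleftrightarrow> q \<in> feasible \<and> (\<forall>q'\<in>feasible. objective z q' \<le> objective z q)"

lemma uniform_feasible: "(\<lambda>i. if i < n then 1 / real n else 0) \<in> feasible"
  using n T by (auto simp: feasible_def prob_simplex_def)

lemma simplex_le_1: "q \<in> prob_simplex n \<Longrightarrow> q i \<le> 1"
proof (cases "i < n")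
  case True
  assume q: "q \<in> prob_simplex n"
  then have "q i \<le> (\<Sum>i<n. q i)"
    using True by (intro member_le_sum) (auto simp: prob_simplex_def)
  then show ?thesis using q by (simp add: prob_simplex_def)
qed (auto simp: prob_simplex_def)

lemma simplex_nonneg: "q \<in> prob_simplex n \<Longrightarrow> 0 \<le> q i"
  by (cases "i < n") (auto simp: prob_simplex_def)

lemma compact_feasible: "compact feasible"
proof -
  have "compactin (product_topology (\<lambda>_. euclideanreal) UNIV) (PiE UNIV (\<lambda>_. {0..1}))"
    by (subst compactin_PiE) auto
  then have "compact (PiE UNIV (\<lambda>_::nat. {0..1::real}))"
    by (simp add: euclidean_product_topology)
  moreover have "closed feasible"
  proof -
    have "feasible = (\<Inter>i<n. {q. 0 \<le> q i}) \<inter> (\<Inter>i\<in>{n..}. {q. q i = 0}) \<inter> {q. (\<Sum>i<n. q i) = 1}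
        \<inter> (\<Inter>i<n. {q. real n * q i \<le> T})"
      by (auto simp: feasible_def prob_simplex_def)
    also have "closed \<dots>"
      by (intro closed_Int closed_INT ballI closed_Collect_le closed_Collect_eq continuous_intros
          continuous_on_product_coordinates)
    finally show ?thesis .
  qed
  moreover have "feasible \<subseteq> PiE UNIV (\<lambda>_. {0..1})"
    by (auto simp: feasible_def simplex_le_1 simplex_nonneg)
  ultimately show ?thesis by (metis compact_Int_closed inf.absorb_iff2)
qed

lemma continuous_objective: "continuous_on (UNIV \<times> feasible) (\<lambda>(z, q). objective z q)"
proof -
  have 1: "continuous_on (UNIV \<times> feasible) (\<lambda>p. snd p i)" for i :: nat
    by (rule continuous_on_product_then_coordinatewise[OF continuous_on_snd[OF continuous_on_id]])
  have 2: "continuous_on (UNIV \<times> feasible) (\<lambda>p. fst p i)" for i :: nat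
    by (rule continuous_on_product_then_coordinatewise[OF continuous_on_fst[OF continuous_on_id]])
  have 3: "continuous_on (UNIV \<times> feasible) (\<lambda>p. \<phi> (real n * snd p i))" if "i < n" for i
    by (intro continuous_on_compose2[OF cont] continuous_intros 1)
       (use that in \<open>auto simp: feasible_def prob_simplex_def\<close>)
  show ?thesis
    unfolding objective_def case_prod_beta'
    by (intro continuous_intros 1 2 3) auto
qed

lemma maximal_exists: "\<exists>q. maximal z q"
proof -
  have "continuous_on feasible (\<lambda>q. (\<lambda>(z, q). objective z q) (z, q))"
    by (intro continuous_on_compose2[OF continuous_objective] continuous_intros) auto
  then show ?thesis
    using continuous_attains_sup[of feasible "objective z"] compact_feasible uniform_feasible
    unfolding maximal_def by auto
qed

lemma shift_mass:
  assumes q: "q \<in> feasible" and jk: "j < n" "k < n" "j \<noteq> k"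
    and e: "0 \<le> e" "e \<le> q k" "real n * (q j + e) \<le> T"
  shows "q(j := q j + e, k := q k - e) \<in> feasible" (is "?q \<in> _")
    and "objective z (q(j := q j + e, k := q k - e)) = objective z q + e * (z j - z k)
      - lam / real n * (\<phi> (real n * q j + real n * e) - \<phi> (real n * q j)
                        + (\<phi> (real n * q k - real n * e) - \<phi> (real n * q k)))"
proof -
  note upd = sum_fun_upd_two[of "{..<n}" j k _ q "q j + e" "q k - e"]
  have "(\<Sum>i<n. ?q i) = 1"
    using upd[of "\<lambda>_ t. t"] q jk by (simp add: feasible_def prob_simplex_def)
  moreover have "real n * (q k - e) \<le> T"
  proof (rule order_trans)
    show "real n * (q k - e) \<le> real n * q k" using e by (simp add: mult_left_mono)
    show "real n * q k \<le> T" using q jk by (simp add: feasible_def)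
  qed
  moreover have "0 \<le> q j" using q by (simp add: feasible_def simplex_nonneg)
  ultimately show "?q \<in> feasible"
    using q jk e by (auto simp: feasible_def prob_simplex_def)
  show "objective z ?q = objective z q + e * (z j - z k)
      - lam / real n * (\<phi> (real n * q j + real n * e) - \<phi> (real n * q j)
                        + (\<phi> (real n * q k - real n * e) - \<phi> (real n * q k)))"
  proof -
    have lin: "(\<Sum>i<n. ?q i * z i)
        = (\<Sum>i<n. q i * z i) + ((q j + e) * z j - q j * z j) + ((q k - e) * z k - q k * z k)"
      using upd[of "\<lambda>i t. t * z i"] jk by (simp del: fun_upd_apply)
    have pen: "(\<Sum>i<n. \<phi> (real n * ?q i)) = (\<Sum>i<n. \<phi> (real n * q i))
        + (\<phi> (real n * (q j + e)) - \<phi> (real n * q j))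
        + (\<phi> (real n * (q k - e)) - \<phi> (real n * q k))"
      using upd[of "\<lambda>i t. \<phi> (real n * t)"] jk by (simp del: fun_upd_apply)
    show ?thesis
      unfolding objective_def lin pen by (simp add: algebra_simps)
  qed
qed

text \<open>
  The key monotonicity property of the maximizers. If, between two loss vectors that agree at \<open>j\<close> and
  \<open>k\<close>, the weight of \<open>j\<close> went up and that of \<open>k\<close> went down, then moving a little mass from \<open>k\<close> to \<open>j\<close> in
  \<open>q\<close> and from \<open>j\<close> to \<open>k\<close> in \<open>q'\<close> would change the two linear terms by opposite amounts and
  strictly lower the sum of the two penalties. So \<open>q\<close> or \<open>q'\<close> could be improved.
\<close>

lemma no_opposite_moves:
  assumes q: "maximal z q" and q': "maximal z' q'"
    and jk: "j < n" "k < n" "z j = z' j" "z k = z' k"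
    and lt: "q j < q' j" "q' k < q k"
  shows False
proof -
  have f: "q \<in> feasible" "q' \<in> feasible" using q q' by (auto simp: maximal_def)
  have "j \<noteq> k" using lt by auto
  \<comment> \<open>Half of the smaller gap, so that neither pair of moving coordinates crosses.\<close>
  define e where "e = min (q' j - q j) (q k - q' k) / 2"
  have e: "0 < e" "q j + e \<le> q' j - e" "q' k + e \<le> q k - e"
    using lt by (auto simp: e_def min_def field_simps)
  have nn: "0 < real n" using n by simp
  have nonneg: "0 \<le> q j" "0 \<le> q' k" "0 \<le> q k" "0 \<le> q' j"
    and le: "real n * q' j \<le> T" "real n * q k \<le> T"
    using f jk by (auto simp: feasible_def prob_simplex_def)
  have sc: "real n * q j + real n * e \<le> real n * q' j - real n * e"
           "real n * q' k + real n * e \<le> real n * q k - real n * e"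
    using mult_left_mono[OF e(2), of "real n"] mult_left_mono[OF e(3), of "real n"] nn
    by (simp_all add: algebra_simps)
  have ne: "0 < real n * e" using nn e by simp
  have cap: "real n * (q j + e) \<le> T" "real n * (q' k + e) \<le> T"
    using sc le ne by (simp_all add: algebra_simps)
  have "e * (z j - z k) - lam / real n * (\<phi> (real n * q j + real n * e) - \<phi> (real n * q j)
        + (\<phi> (real n * q k - real n * e) - \<phi> (real n * q k))) \<le> 0"
    using shift_mass(1)[OF f(1) jk(1,2) \<open>j \<noteq> k\<close>, of e] shift_mass(2)[OF f(1) jk(1,2) \<open>j \<noteq> k\<close>, of e z]
      q e nonneg cap unfolding maximal_def by fastforce
  moreover have "e * (z k - z j) - lam / real n * (\<phi> (real n * q' k + real n * e) - \<phi> (real n * q' k)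
        + (\<phi> (real n * q' j - real n * e) - \<phi> (real n * q' j))) \<le> 0"
    using shift_mass(1)[OF f(2) jk(2,1) \<open>j \<noteq> k\<close>[symmetric], of e]
      shift_mass(2)[OF f(2) jk(2,1) \<open>j \<noteq> k\<close>[symmetric], of e z'] q' e nonneg cap jk
    unfolding maximal_def by fastforce
  moreover have "e * (z k - z j) = - (e * (z j - z k))" by (simp add: algebra_simps)
  ultimately have "0 \<le> lam / real n * ((\<phi> (real n * q j + real n * e) - \<phi> (real n * q j)
        + (\<phi> (real n * q k - real n * e) - \<phi> (real n * q k)))
      + (\<phi> (real n * q' k + real n * e) - \<phi> (real n * q' k)
        + (\<phi> (real n * q' j - real n * e) - \<phi> (real n * q' j))))"
    by (simp only: distrib_left right_diff_distrib)
  then have "0 \<le> (\<phi> (real n * q j + real n * e) - \<phi> (real n * q j)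
        + (\<phi> (real n * q k - real n * e) - \<phi> (real n * q k)))
      + (\<phi> (real n * q' k + real n * e) - \<phi> (real n * q' k)
        + (\<phi> (real n * q' j - real n * e) - \<phi> (real n * q' j)))"
    using lam nn by (simp add: zero_le_mult_iff zero_le_divide_iff)
  moreover note exchange[OF _ ne sc(1) le(1)] exchange[OF _ ne sc(2) le(2)]
  ultimately show False using nn nonneg by simp
qed

text \<open>
  The case \<open>z = z'\<close> of \<open>no_opposite_moves\<close>: as the total masses agree, two different maximizers would have
  moved in opposite directions somewhere.
\<close>

lemma maximal_unique:
  assumes "maximal z q" "maximal z q'"
  shows "q = q'"
proof (rule ccontr)
  have *: False if "maximal z q" "maximal z q'" "q j < q' j" for q q' j
  proof -
    have "j < n" using that by (cases "j < n") (auto simp: maximal_def feasible_def prob_simplex_def)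
    moreover have "sum q {..<n} = sum q' {..<n}"
      using that by (auto simp: maximal_def feasible_def prob_simplex_def)
    ultimately obtain k where "k < n" "q' k < q k"
      using exists_less_if_sum_eq[of "{..<n}" q q' j] \<open>q j < q' j\<close> by auto
    then show False using no_opposite_moves[OF that(1,2) \<open>j < n\<close>, of k] that(3) by simp
  qed
  assume "q \<noteq> q'"
  then obtain j where "q j \<noteq> q' j" by auto
  then show False using *[OF assms, of j] *[OF assms(2,1), of j] by linarith
qed

text \<open>
  When only the loss at \<open>i\<close> changes, all other weights move in the same direction, so their changes
  add up without cancellation to the mass that \<open>i\<close> gains or loses.
\<close>

lemma total_change_of_other_weights:
  assumes q: "maximal z q" and q': "maximal z' q'" and i: "i < n"
    and z: "\<And>j. j < n \<Longrightarrow> j \<noteq> i \<Longrightarrow> z j = z' j"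
  shows "(\<Sum>j\<in>{..<n} - {i}. \<bar>q j - q' j\<bar>) = \<bar>q i - q' i\<bar>"
proof -
  have "(\<Sum>j<n. q j) = (\<Sum>j<n. q' j)"
    using q q' by (auto simp: maximal_def feasible_def prob_simplex_def)
  then have s: "(\<Sum>j\<in>{..<n} - {i}. q j - q' j) = q' i - q i"
    using i by (simp add: sum_subtractf sum.remove[of "{..<n}" i])
  consider "\<forall>j\<in>{..<n} - {i}. q j \<le> q' j" | "\<forall>j\<in>{..<n} - {i}. q' j \<le> q j"
    using no_opposite_moves[OF q q'] z by (metis DiffD1 DiffD2 insertI1 lessThan_iff linorder_not_le)
  then show ?thesis
  proof cases
    case 1
    then have "(\<Sum>j\<in>{..<n} - {i}. \<bar>q j - q' j\<bar>) = (\<Sum>j\<in>{..<n} - {i}. - (q j - q' j))"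
      by (intro sum.cong) auto
    also have "\<dots> = q i - q' i" using s by (simp only: sum_negf)
    finally show ?thesis
      by (metis abs_of_nonneg sum_nonneg abs_ge_zero)
  next
    case 2
    then have "(\<Sum>j\<in>{..<n} - {i}. \<bar>q j - q' j\<bar>) = (\<Sum>j\<in>{..<n} - {i}. q j - q' j)"
      by (intro sum.cong) auto
    then show ?thesis
      using s by (metis abs_minus_commute abs_of_nonneg sum_nonneg abs_ge_zero)
  qed
qed

definition weights :: "(nat \<Rightarrow> real) \<Rightarrow> nat \<Rightarrow> real" where
  "weights z = (THE q. maximal z q)"

lemma maximal_weights: "maximal z (weights z)"
  unfolding weights_def using maximal_exists maximal_unique by (metis theI)

lemma weights_eq: "maximal z q \<Longrightarrow> weights z = q"
  using maximal_weights maximal_unique by blast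

text \<open>
  Berge's maximum theorem for a unique maximizer: the preimage of a closed set \<open>C\<close> is the projection
  of the closed set of pairs \<open>(z, q)\<close> with \<open>q \<in> C\<close> maximal for \<open>z\<close>, and projecting along the compact
  feasible set is a closed map.
\<close>

lemma continuous_weights: "continuous_on UNIV weights"
proof (subst continuous_on_closed_vimage[OF closed_UNIV], intro allI impI)
  fix C :: "(nat \<Rightarrow> real) set"
  assume C: "closed C"
  define S where "S = {(z, q). q \<in> feasible \<and> q \<in> C \<and> (\<forall>q'\<in>feasible. objective z q' \<le> objective z q)}"
  have top: "prod_topology euclidean (top_of_set feasible)
      = top_of_set (UNIV \<times> feasible :: ((nat \<Rightarrow> real) \<times> (nat \<Rightarrow> real)) set)"
    by (metis prod_topology_subtopology_eu subtopology_UNIV)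
  have *: "closed (UNIV \<times> feasible :: ((nat \<Rightarrow> real) \<times> (nat \<Rightarrow> real)) set)"
    by (intro closed_Times compact_imp_closed[OF compact_feasible] closed_UNIV)
  have "S = (UNIV \<times> C) \<inter>
      (\<Inter>q'\<in>feasible. {p \<in> UNIV \<times> feasible. (\<lambda>(z, q). objective z q) (fst p, q') \<le> (\<lambda>(z, q). objective z q) p})"
    using uniform_feasible by (auto simp: S_def)
  also have "closed \<dots>"
    by (intro closed_Int closed_Times closed_INT ballI continuous_on_closed_Collect_le * C
          closed_UNIV continuous_objective continuous_on_compose2[OF continuous_objective]
          continuous_intros) auto
  finally have "closedin (prod_topology euclidean (top_of_set feasible)) S"
    unfolding top by (intro closed_subset) (auto simp: S_def)
  moreover have "closed_map (prod_topology euclidean (top_of_set feasible)) euclidean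
     (fst :: (nat \<Rightarrow> real) \<times> (nat \<Rightarrow> real) \<Rightarrow> _)"
    by (rule Abstract_Topological_Spaces.closed_map_fst)
       (use compact_feasible in \<open>simp add: compact_space_subtopology\<close>)
  ultimately have "closed (fst ` S)" by (simp add: closed_map_def)
  moreover have "weights -` C = fst ` S"
  proof (intro equalityI image_subsetI subsetI)
    fix z assume "z \<in> weights -` C"
    then have "(z, weights z) \<in> S" using maximal_weights[of z] by (simp add: S_def maximal_def)
    then show "z \<in> fst ` S" by (metis fst_conv imageI)
  next
    fix p assume "p \<in> S"
    then have "maximal (fst p) (snd p)" "snd p \<in> C" by (auto simp: S_def maximal_def)
    then show "fst p \<in> weights -` C" by (simp add: weights_eq)
  qed
  ultimately show "closed (weights -` C \<inter> UNIV)" by simp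
qed

lemma weights_cong:
  assumes "\<And>i. i < n \<Longrightarrow> z i = z' i"
  shows "weights z = weights z'"
proof -
  have "objective z q = objective z' q" for q
    unfolding objective_def using assms by simp
  then show ?thesis by (simp add: weights_def maximal_def)
qed

lemma measurable_weights:
  assumes [measurable]: "\<And>i. i < n \<Longrightarrow> (\<lambda>s. z s i) \<in> borel_measurable N"
  shows "(\<lambda>s. weights (z s) i) \<in> borel_measurable N"
proof -
  \<comment> \<open>Filling the coordinates from \<open>n\<close> on with \<open>0\<close> makes the whole loss vector measurable.\<close>
  define z' where "z' s i = (if i < n then z s i else 0)" for s i
  have "(\<lambda>s. z' s j) \<in> borel_measurable N" for j
    by (cases "j < n") (simp_all add: z'_def)
  then have [measurable]: "z' \<in> borel_measurable N" by (rule measurable_coordinatewise_then_product)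
  have "continuous_on UNIV (\<lambda>z. weights z i)"
    by (rule continuous_on_product_then_coordinatewise[OF continuous_weights])
  then have "(\<lambda>s. weights (z' s) i) \<in> borel_measurable N"
    by (intro measurable_compose[OF \<open>z' \<in> borel_measurable N\<close>] borel_measurable_continuous_onI)
  moreover have "weights (z s) = weights (z' s)" for s
    by (rule weights_cong) (simp add: z'_def)
  ultimately show ?thesis by simp
qed

lemma weights_simplex: "weights z \<in> prob_simplex n"
  using maximal_weights[of z] by (simp add: maximal_def feasible_def)

text \<open>
  Above the cap the penalty is infinite, so maximizing the extended-real objective over the simplex
  amounts to maximizing the real-valued one over the compact feasible set.
\<close>

lemma penalized_value_eq:
  assumes "q \<in> prob_simplex n"
  shows "penalized_value \<psi> lam n z q = (if q \<in> feasible then ereal (objective z q) else -\<infinity>)"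
proof -
  have range: "0 \<le> real n * q i" "real n * q i \<le> real n" if "i < n" for i
    using assms that simplex_le_1[OF assms, of i] by (auto simp: prob_simplex_def mult_left_le)
  have "0 < real n" using n by simp
  show ?thesis
  proof (cases "q \<in> feasible")
    case True
    then have "(\<Sum>i<n. \<psi> (real n * q i)) = (\<Sum>i<n. ereal (\<phi> (real n * q i)))"
      by (intro sum.cong) (auto simp: psi range feasible_def)
    then show ?thesis using True by (simp add: penalized_value_def objective_def)
  next
    case False
    then obtain i where "i < n" "T < real n * q i" using assms by (auto simp: feasible_def not_le)
    then have "(\<Sum>i<n. \<psi> (real n * q i)) = \<infinity>"
      by (auto simp: sum_Pinfty psi range intro!: bexI[of _ i])
    then show ?thesis using False lam n by (simp add: penalized_value_def)
  qed
qed

lemma worst_weights_eq: "worst_weights \<psi> lam n loss x s = weights (\<lambda>i. loss x (s i))"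
proof -
  let ?z = "\<lambda>i. loss x (s i)"
  have w: "weights ?z \<in> feasible" "\<And>q. q \<in> feasible \<Longrightarrow> objective ?z q \<le> objective ?z (weights ?z)"
    using maximal_weights[of ?z] by (auto simp: maximal_def)
  have sub: "feasible \<subseteq> prob_simplex n" by (auto simp: feasible_def)
  have rob: "robust_loss \<psi> lam n loss x s = ereal (objective ?z (weights ?z))"
    unfolding robust_loss_def
  proof (rule antisym)
    show "(SUP q\<in>prob_simplex n. penalized_value \<psi> lam n ?z q) \<le> ereal (objective ?z (weights ?z))"
      using w by (intro SUP_least) (simp add: penalized_value_eq)
    show "ereal (objective ?z (weights ?z)) \<le> (SUP q\<in>prob_simplex n. penalized_value \<psi> lam n ?z q)"
      using w sub by (intro SUP_upper2[of "weights ?z"]) (auto simp: penalized_value_eq)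
  qed
  have "q \<in> prob_simplex n \<and> penalized_value \<psi> lam n ?z q = robust_loss \<psi> lam n loss x s
      \<longleftrightarrow> maximal ?z q" for q
  proof
    assume q: "q \<in> prob_simplex n \<and> penalized_value \<psi> lam n ?z q = robust_loss \<psi> lam n loss x s"
    then have "q \<in> feasible" "objective ?z q = objective ?z (weights ?z)"
      using rob by (auto simp: penalized_value_eq split: if_splits)
    then show "maximal ?z q" using w by (auto simp: maximal_def)
  next
    assume "maximal ?z q"
    then have "q = weights ?z" using weights_eq by simp
    then show "q \<in> prob_simplex n \<and> penalized_value \<psi> lam n ?z q = robust_loss \<psi> lam n loss x s"
      using w sub rob by (auto simp: penalized_value_eq)
  qed
  then show ?thesis unfolding worst_weights_def weights_def by simp
qed

end

section \<open>The two penalties\<close>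

lemma weight_penalty_klcvar:
  assumes "1 \<le> n" "0 < lam" "0 < \<alpha>" "\<alpha> \<le> 1"
  shows "weight_penalty (psi_klcvar \<alpha>) (\<lambda>t. t * ln t - t + 1) (1 / \<alpha>) lam n"
proof
  let ?\<phi> = "\<lambda>t::real. t * ln t - t + 1"
  have deriv: "(?\<phi> has_real_derivative ln t) (at t)" if "0 < t" for t
    using that by (auto intro!: derivative_eq_intros)
  show cont: "continuous_on {0..1 / \<alpha>} ?\<phi>"
    unfolding continuous_on_eq_continuous_within
  proof
    fix t assume t: "t \<in> {0..1 / \<alpha>}"
    show "continuous (at t within {0..1 / \<alpha>}) ?\<phi>"
    proof (cases "t = 0")
      case True
      have "(?\<phi> \<longlongrightarrow> 1) (at_right 0)" by real_asymp
      then show ?thesis using assms True by (simp add: continuous_within at_within_Icc_at_right)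
    next
      case False
      then have "0 < t" using t by simp
      then show ?thesis
        by (rule continuous_at_imp_continuous_at_within[OF DERIV_isCont[OF deriv]])
    qed
  qed
  show "?\<phi> (a + e) + ?\<phi> (b - e) < ?\<phi> a + ?\<phi> b"
    if "0 \<le> a" "0 < e" "a + e \<le> b - e" "b \<le> 1 / \<alpha>" for a b e
    by (rule exchange_of_increasing_derivative[where D = ln, OF cont deriv _ that])
       (assumption, simp)
qed (use assms in \<open>auto simp: psi_klcvar_def\<close>)

lemma weight_penalty_chi2:
  assumes "1 \<le> n" "0 < lam"
  shows "weight_penalty psi_chi2 (\<lambda>t. (t - 1)\<^sup>2 / 2) (real n) lam n"
proof
  let ?\<phi> = "\<lambda>t::real. (t - 1)\<^sup>2 / 2"
  show cont: "continuous_on {0..real n} ?\<phi>" by (intro continuous_intros) auto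
  have deriv: "(?\<phi> has_real_derivative t - 1) (at t)" for t
    by (auto intro!: derivative_eq_intros)
  show "?\<phi> (a + e) + ?\<phi> (b - e) < ?\<phi> a + ?\<phi> b"
    if "0 \<le> a" "0 < e" "a + e \<le> b - e" "b \<le> real n" for a b e
    by (rule exchange_of_increasing_derivative[OF cont deriv _ that]) auto
qed (use assms in \<open>auto simp: psi_chi2_def\<close>)

section \<open>Variance of the mini-batch gradient\<close>

context dro_setting
begin

lemma G_nonneg: "0 \<le> G"
  using loss_lipschitz not_empty lipschitz_on_nonneg by blast

text \<open>
  At an interior point one can step a little in the direction of the subgradient itself; the loss
  then grows at least at the rate \<open>norm (dl x s)\<close>, and at most at the rate \<open>G\<close>. At all other points the
  bound is part of the setting.
\<close>

lemma norm_dl_le: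
  assumes x: "x \<in> X" and s: "s \<in> space P0"
  shows "norm (dl x s) \<le> G"
proof (cases "x \<in> interior X \<and> dl x s \<noteq> 0")
  case False
  then show ?thesis using dl_boundary[OF x _ s] G_nonneg by auto
next
  case True
  then obtain r where r: "0 < r" "cball x r \<subseteq> X"
    by (meson mem_interior_cball)
  define y where "y = x + (r / norm (dl x s)) *\<^sub>R dl x s"
  have d: "dist y x = r" using True r by (simp add: y_def dist_norm)
  then have y: "y \<in> X" using r by (auto simp: dist_commute)
  have "r * norm (dl x s) = dl x s \<bullet> (y - x)"
    using True by (simp add: y_def power2_norm_eq_inner[symmetric] power2_eq_square)
  also have "\<dots> \<le> loss y s - loss x s"
    using dl_subgradient[OF x y s] by simp
  also have "\<dots> \<le> G * dist y x"
    using lipschitz_onD[OF loss_lipschitz[OF s] y x] by (simp add: dist_real_def)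
  finally show ?thesis using d r by (simp add: mult.commute)
qed

text \<open>
  The old summand at \<open>i\<close> contributes at most \<open>G * q i\<close>, the new one at most \<open>G * q' i\<close>, and all others
  together at most \<open>G * \<bar>q' i - q i\<bar>\<close>. These add up to \<open>2 * G * max (q' i) (q i)\<close>.
\<close>

lemma norm_weighted_gradient_diff_le:
  fixes q q' :: "nat \<Rightarrow> real"
  assumes q: "\<And>j. j < n \<Longrightarrow> 0 \<le> q j" and q': "\<And>j. j < n \<Longrightarrow> 0 \<le> q' j"
    and pert: "(\<Sum>j\<in>{..<n} - {i}. \<bar>q' j - q j\<bar>) = \<bar>q' i - q i\<bar>"
    and x: "x \<in> X" and i: "i < n" and t: "t \<in> space P0"
    and s: "\<And>j. j < n \<Longrightarrow> s j \<in> space P0"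
  shows "(norm ((\<Sum>j<n. q' j *\<^sub>R dl x ((s(i := t)) j)) - (\<Sum>j<n. q j *\<^sub>R dl x (s j))))\<^sup>2
    \<le> 4 * G\<^sup>2 * ((q' i)\<^sup>2 + (q i)\<^sup>2)"
proof -
  have "(\<Sum>j<n. q' j *\<^sub>R dl x ((s(i := t)) j)) - (\<Sum>j<n. q j *\<^sub>R dl x (s j))
      = q' i *\<^sub>R dl x t - q i *\<^sub>R dl x (s i) + (\<Sum>j\<in>{..<n} - {i}. (q' j - q j) *\<^sub>R dl x (s j))"
  proof -
    have "(\<Sum>j<n. q' j *\<^sub>R dl x ((s(i := t)) j))
        = q' i *\<^sub>R dl x t + (\<Sum>j\<in>{..<n} - {i}. q' j *\<^sub>R dl x (s j))"
      using i sum.remove[of "{..<n}" i "\<lambda>j. q' j *\<^sub>R dl x ((s(i := t)) j)"] by simp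
    moreover have "(\<Sum>j<n. q j *\<^sub>R dl x (s j))
        = q i *\<^sub>R dl x (s i) + (\<Sum>j\<in>{..<n} - {i}. q j *\<^sub>R dl x (s j))"
      using i sum.remove[of "{..<n}" i "\<lambda>j. q j *\<^sub>R dl x (s j)"] by simp
    ultimately show ?thesis by (simp add: scaleR_left_diff_distrib sum_subtractf)
  qed
  also have "norm \<dots> \<le> q' i * G + q i * G + (\<Sum>j\<in>{..<n} - {i}. \<bar>q' j - q j\<bar> * G)"
    using norm_dl_le[OF x] s t i q q'
    by (intro norm_triangle_mono order_trans[OF norm_triangle_ineq4] add_mono sum_norm_le)
       (auto intro!: mult_left_mono)
  also have "\<dots> = (q' i + q i + \<bar>q' i - q i\<bar>) * G"
    unfolding sum_distrib_right[symmetric] pert by (simp add: algebra_simps)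
  also have "q' i + q i + \<bar>q' i - q i\<bar> = 2 * max (q' i) (q i)" by auto
  finally have "(norm ((\<Sum>j<n. q' j *\<^sub>R dl x ((s(i := t)) j)) - (\<Sum>j<n. q j *\<^sub>R dl x (s j))))\<^sup>2
      \<le> (2 * max (q' i) (q i) * G)\<^sup>2"
    by (intro power_mono) auto
  also have "\<dots> = 4 * G\<^sup>2 * (max (q' i) (q i))\<^sup>2" by (simp add: power_mult_distrib)
  also have "\<dots> \<le> 4 * G\<^sup>2 * ((q' i)\<^sup>2 + (q i)\<^sup>2)"
    by (intro mult_left_mono) (auto simp: max_def)
  finally show ?thesis .
qed

text \<open>
  By the Efron--Stein inequality the variance is at most the sum over \<open>i\<close> of the mean square change
  when sample \<open>i\<close> is redrawn. Each change is controlled by \<open>4 * G\<^sup>2\<close> times the squared weight of \<open>i\<close> before and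
  after redrawing, and both have the same distribution, whence the constant \<open>8\<close>.
\<close>

lemma variance_batch_gradient_le:
  assumes pen: "weight_penalty \<psi> \<phi> T lam n" and x: "x \<in> X" and iid: "iid_sample M P0 n S"
    and D: "\<And>s. s \<in> space (PiM {..<n} (\<lambda>_. P0)) \<Longrightarrow>
      (\<Sum>i<n. (worst_weights \<psi> lam n loss x s i)\<^sup>2) \<le> D"
  shows "vec_variance M (\<lambda>\<omega>. batch_gradient \<psi> lam n loss dl x (\<lambda>i. S i \<omega>)) \<le> 8 * G\<^sup>2 * D"
proof -
  interpret weight_penalty \<psi> \<phi> T lam n by (rule pen)
  let ?P = "PiM {..<n} (\<lambda>_. P0)"
  interpret P: prob_space ?P by (intro prob_space_PiM prob_space_axioms)
  interpret M: prob_space M using iid by (simp add: iid_sample_def)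
  define w where "w s = weights (\<lambda>i. loss x (s i))" for s :: "nat \<Rightarrow> 's"
  define V where "V s = (\<Sum>i<n. w s i *\<^sub>R dl x (s i))" for s
  have V: "batch_gradient \<psi> lam n loss dl x s = V s" for s
    by (simp add: batch_gradient_def V_def w_def worst_weights_eq)
  have w_cong: "w s = w s'" if "\<And>i. i < n \<Longrightarrow> s i = s' i" for s s'
    unfolding w_def using that by (intro weights_cong) simp
  have w01: "0 \<le> w s i" "w s i \<le> 1" for s i
    using simplex_nonneg[OF weights_simplex] simplex_le_1[OF weights_simplex] by (auto simp: w_def)
  have sp: "s i \<in> space P0" if "s \<in> space ?P" "i < n" for s i
    using that by (auto simp: space_PiM)
  have comp: "(\<lambda>s. s i) \<in> measurable ?P P0" if "i < n" for i
    using that by (intro measurable_component_singleton) simp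
  have w_meas[measurable]: "(\<lambda>s. w s i) \<in> borel_measurable ?P" for i
    unfolding w_def
    by (intro measurable_weights measurable_compose[OF comp loss_measurable[OF x]])
  have V_meas[measurable]: "V \<in> borel_measurable ?P"
    unfolding V_def
    by (intro borel_measurable_sum borel_measurable_scaleR w_meas
              measurable_compose[OF comp dl_measurable[OF x]]) auto
  have V_le: "norm (V s) \<le> G" if "s \<in> space ?P" for s
  proof -
    have "norm (V s) \<le> (\<Sum>i<n. w s i * G)"
      unfolding V_def using norm_dl_le[OF x sp[OF that]] w01
      by (intro sum_norm_le) (auto intro!: mult_left_mono)
    also have "\<dots> = G"
      using weights_simplex[of "\<lambda>i. loss x (s i)"]
      sum_distrib_right[of "w s" "{..<n}" G] by (simp add: w_def prob_simplex_def)
    finally show ?thesis .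
  qed
  have rv: "S i \<in> measurable M P0" if "i < n" for i
    using iid that by (auto simp: iid_sample_def M.indep_vars_def)
  have "distr M ?P (\<lambda>\<omega>. \<lambda>i\<in>{..<n}. S i \<omega>) = (\<Pi>\<^sub>M i\<in>{..<n}. distr M P0 (S i))"
    using iid n rv M.indep_vars_iff_distr_eq_PiM'[of "{..<n}" S "\<lambda>_. P0"]
    by (auto simp: iid_sample_def lessThan_empty_iff)
  also have "\<dots> = ?P"
    using iid by (intro PiM_cong) (auto simp: iid_sample_def)
  finally have distr: "distr M ?P (\<lambda>\<omega>. \<lambda>i\<in>{..<n}. S i \<omega>) = ?P" .
  \<comment> \<open>Independence and identical distribution turn the sample into a point of the product space.\<close>
  have "vec_variance M (\<lambda>\<omega>. V (\<lambda>i. S i \<omega>)) = vec_variance M (\<lambda>\<omega>. V (\<lambda>i\<in>{..<n}. S i \<omega>))"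
  proof -
    have "V (\<lambda>i. S i \<omega>) = V (\<lambda>i\<in>{..<n}. S i \<omega>)" for \<omega>
      unfolding V_def using w_cong[of "\<lambda>i. S i \<omega>" "\<lambda>i\<in>{..<n}. S i \<omega>"] by simp
    then show ?thesis by simp
  qed
  also have "\<dots> = vec_variance ?P V"
    using vec_variance_distr[OF measurable_restrict[of "{..<n}" S M "\<lambda>_. P0"] V_meas] rv
    by (simp add: distr)
  also have "\<dots> \<le> (\<Sum>i<n. \<integral>s. vec_variance P0 (\<lambda>t. V (s(i := t))) \<partial>?P)"
    by (rule variance_tensorization[where M = "\<lambda>_. P0" and c = G])
       (auto simp: V_le prob_space_axioms)
  also have "\<dots> \<le> (\<Sum>i<n. 8 * G\<^sup>2 * (\<integral>s. (w s i)\<^sup>2 \<partial>?P))"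
  proof (intro sum_mono)
    fix i assume "i \<in> {..<n}"
    then have i: "i < n" by simp
    have upd: "s(i := t) \<in> space ?P" if "s \<in> space ?P" "t \<in> space P0" for s t
      using that i by (auto simp: space_PiM PiE_def extensional_def)
    have Iw: "integrable ?P (\<lambda>s. (w s i)\<^sup>2)"
      using w01 by (intro P.integrable_const_bound[of _ 1] AE_I2) (auto intro: power_le_one)
    interpret NK: pair_prob_space ?P P0 ..
    note resample = integral_resample[where M = "\<lambda>_. P0" and j = i and I = "{..<n}",
        OF prob_space_axioms _ Iw]
    have Ir: "integrable ?P (\<lambda>s. \<integral>t. (w (s(i := t)) i)\<^sup>2 \<partial>P0)"
      using NK.integrable_fst[OF resample(1)] i by simp
    have "(\<integral>s. vec_variance P0 (\<lambda>t. V (s(i := t))) \<partial>?P)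
        \<le> (\<integral>s. 4 * G\<^sup>2 * ((\<integral>t. (w (s(i := t)) i)\<^sup>2 \<partial>P0) + (w s i)\<^sup>2) \<partial>?P)"
    proof (intro integral_mono_AE' AE_I2)
      fix s assume s: "s \<in> space ?P"
      have upd_meas: "(\<lambda>t. s(i := t)) \<in> measurable P0 ?P"
        using measurable_Pair2[OF measurable_resample[of i "{..<n}" "\<lambda>_. P0"] s] i by simp
      have Vs: "(\<lambda>t. V (s(i := t))) \<in> borel_measurable P0"
        by (rule measurable_compose[OF upd_meas V_meas])
      have Iws: "integrable P0 (\<lambda>t. (w (s(i := t)) i)\<^sup>2)"
        using w01 measurable_compose[OF upd_meas w_meas]
        by (intro integrable_const_bound[of _ 1] AE_I2 borel_measurable_power)
           (auto intro: power_le_one)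
      \<comment> \<open>The gradient \<open>V s\<close> at the original sample serves as the constant approximation.\<close>
      have "vec_variance P0 (\<lambda>t. V (s(i := t))) \<le> (\<integral>t. (norm (V (s(i := t)) - V s))\<^sup>2 \<partial>P0)"
        using upd s V_le by (intro vec_variance_le[of _ G] Vs) auto
      also have "\<dots> \<le> (\<integral>t. 4 * G\<^sup>2 * ((w (s(i := t)) i)\<^sup>2 + (w s i)\<^sup>2) \<partial>P0)"
      proof (intro integral_mono_AE' AE_I2)
        fix t assume t: "t \<in> space P0"
        have "(\<Sum>j\<in>{..<n} - {i}. \<bar>w (s(i := t)) j - w s j\<bar>) = \<bar>w (s(i := t)) i - w s i\<bar>"
          unfolding w_def by (rule total_change_of_other_weights[OF maximal_weights maximal_weights i]) simp
        then show "(norm (V (s(i := t)) - V s))\<^sup>2 \<le> 4 * G\<^sup>2 * ((w (s(i := t)) i)\<^sup>2 + (w s i)\<^sup>2)"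
          unfolding V_def using w01 sp[OF s] by (intro norm_weighted_gradient_diff_le x i t) auto
      qed (use Iws in auto)
      also have "\<dots> = 4 * G\<^sup>2 * ((\<integral>t. (w (s(i := t)) i)\<^sup>2 \<partial>P0) + (w s i)\<^sup>2)"
        using Iws by (simp add: prob_space)
      finally show "vec_variance P0 (\<lambda>t. V (s(i := t)))
          \<le> 4 * G\<^sup>2 * ((\<integral>t. (w (s(i := t)) i)\<^sup>2 \<partial>P0) + (w s i)\<^sup>2)" .
    qed (use Ir Iw in \<open>auto simp: vec_variance_nonneg\<close>)
    also have "\<dots> = 4 * G\<^sup>2 * ((\<integral>s. \<integral>t. (w (s(i := t)) i)\<^sup>2 \<partial>P0 \<partial>?P) + (\<integral>s. (w s i)\<^sup>2 \<partial>?P))"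
      using Ir Iw by simp
    also have "\<dots> = 8 * G\<^sup>2 * (\<integral>s. (w s i)\<^sup>2 \<partial>?P)"
      using resample(2) i by simp
    finally show "(\<integral>s. vec_variance P0 (\<lambda>t. V (s(i := t))) \<partial>?P) \<le> 8 * G\<^sup>2 * (\<integral>s. (w s i)\<^sup>2 \<partial>?P)" .
  qed
  also have "\<dots> = 8 * G\<^sup>2 * (\<integral>s. (\<Sum>i<n. (w s i)\<^sup>2) \<partial>?P)"
  proof (subst Bochner_Integration.integral_sum)
    show "integrable ?P (\<lambda>s. (w s i)\<^sup>2)" for i
      using w01 by (intro P.integrable_const_bound[of _ 1] AE_I2) (auto intro: power_le_one)
  qed (simp add: sum_distrib_left)
  also have "\<dots> \<le> 8 * G\<^sup>2 * D"
  proof (rule mult_left_mono)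
    have D': "(\<Sum>i<n. (w s i)\<^sup>2) \<le> D" if "s \<in> space ?P" for s
      using D[OF that] by (simp add: w_def worst_weights_eq)
    then show "(\<integral>s. (\<Sum>i<n. (w s i)\<^sup>2) \<partial>?P) \<le> D"
      by (intro P.integral_le_const AE_I2 P.integrable_const_bound[of _ D]) (auto simp: sum_nonneg)
  qed simp
  finally show ?thesis by (simp add: V)
qed

end

section \<open>Sums of squared weights\<close>

lemma (in weight_penalty) sum_squares_feasible_le:
  assumes q: "q \<in> feasible"
  shows "(\<Sum>i<n. (q i)\<^sup>2) \<le> T / real n"
proof -
  have "(\<Sum>i<n. (q i)\<^sup>2) \<le> (\<Sum>i<n. q i * (T / real n))"
  proof (rule sum_mono)
    fix i assume "i \<in> {..<n}"
    then have "q i \<le> T / real n" "0 \<le> q i"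
      using q n by (auto simp: feasible_def prob_simplex_def field_simps)
    then show "(q i)\<^sup>2 \<le> q i * (T / real n)" 
      using mult_left_mono[of "q i" "T / real n" "q i"] by (simp only: power2_eq_square)
  qed
  also have "\<dots> = (\<Sum>i<n. q i) * (T / real n)" by (rule sum_distrib_right[symmetric])
  also have "\<dots> = T / real n"
    using q by (simp add: feasible_def prob_simplex_def)
  finally show ?thesis .
qed

text \<open>
  With uniform weights the penalty vanishes and the objective is non-negative, so at the maximizer the
  penalty is at most the linear term, which is at most \<open>B\<close>. The chi-square penalty is itself an affine
  function of the sum of the squared weights.
\<close>

lemma sum_squares_chi2_le:
  assumes n: "1 \<le> n" and lam: "0 < lam" and z: "\<And>i. i < n \<Longrightarrow> loss x (s i) \<in> {0..B}"
  shows "(\<Sum>i<n. (worst_weights psi_chi2 lam n loss x s i)\<^sup>2) \<le> (1 + 2 * B / lam) / real n"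
proof -
  interpret weight_penalty psi_chi2 "\<lambda>t. (t - 1)\<^sup>2 / 2" "real n" lam n
    by (rule weight_penalty_chi2[OF n lam])
  define z where "z i = loss x (s i)" for i
  define q where "q = weights z"
  define u where "u i = (if i < n then 1 / real n else 0)" for i
  have nn: "0 < real n" using n by simp
  have q: "(\<Sum>i<n. q i) = 1" "0 \<le> q i" for i
    using weights_simplex[of z] simplex_nonneg[OF weights_simplex] by (auto simp: q_def prob_simplex_def)
  have "objective z u \<le> objective z q"
    using maximal_weights[of z] uniform_feasible unfolding maximal_def q_def u_def by blast
  moreover have "0 \<le> objective z u"
    using nn z by (auto simp: objective_def u_def z_def intro!: sum_nonneg)
  moreover have "(\<Sum>i<n. q i * z i) \<le> (\<Sum>i<n. q i * B)"
    using q z by (intro sum_mono mult_left_mono) (auto simp: z_def)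
  moreover have "(\<Sum>i<n. q i * B) = B" using q sum_distrib_right[of q "{..<n}" B] by simp
  moreover have "(\<Sum>i<n. (real n * q i - 1)\<^sup>2 / 2) = real n * (real n * (\<Sum>i<n. (q i)\<^sup>2) - 1) / 2"
  proof -
    have "(\<Sum>i<n. (real n * q i - 1)\<^sup>2 / 2)
        = (\<Sum>i<n. (real n)\<^sup>2 / 2 * (q i)\<^sup>2 - real n * q i + 1 / 2)"
      by (intro sum.cong) (auto simp: power2_eq_square field_simps)
    also have "\<dots> = (real n)\<^sup>2 / 2 * (\<Sum>i<n. (q i)\<^sup>2) - real n * (\<Sum>i<n. q i) + real n / 2"
      by (simp add: sum.distrib sum_subtractf sum_distrib_left)
    finally show ?thesis using q by (simp add: power2_eq_square field_simps)
  qed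
  ultimately have "lam * (real n * (\<Sum>i<n. (q i)\<^sup>2) - 1) / 2 \<le> B"
    using nn by (simp add: objective_def)
  then have "(\<Sum>i<n. (q i)\<^sup>2) \<le> (1 + 2 * B / lam) / real n"
    using lam nn by (simp add: field_simps)
  then show ?thesis by (simp add: worst_weights_eq q_def z_def[abs_def])
qed

section \<open>The variance bounds\<close>

theorem proposition2:
  "\<exists>C::real. 0 < C \<and> C \<le> 100 \<and>
     (\<forall>(P0 :: 's measure) (X :: 'a::euclidean_space set) R B G loss dl
        (M :: 'w measure) S n x lam \<alpha>.
        dro_setting P0 X R B G loss dl \<longrightarrow>
        n \<ge> 1 \<longrightarrow> x \<in> X \<longrightarrow> lam > 0 \<longrightarrow> 0 < \<alpha> \<longrightarrow> \<alpha> \<le> 1 \<longrightarrow>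
        iid_sample M P0 n S \<longrightarrow>
          vec_variance M (\<lambda>\<omega>. batch_gradient (psi_klcvar \<alpha>) lam n loss dl x (\<lambda>i. S i \<omega>))
            \<le> C * (G\<^sup>2 / (\<alpha> * real n)) \<and>
          vec_variance M (\<lambda>\<omega>. batch_gradient psi_chi2 lam n loss dl x (\<lambda>i. S i \<omega>))
            \<le> C * (G\<^sup>2 * (1 + B / lam) / real n))"
proof (intro exI[of _ 16] conjI allI impI)
  fix P0 :: "'s measure" and X :: "'a set" and R B G loss dl and M :: "'w measure"
    and S :: "nat \<Rightarrow> 'w \<Rightarrow> 's" and n :: nat and x and lam \<alpha> :: real
  assume dro: "dro_setting P0 X R B G loss dl" and n: "1 \<le> n" and x: "x \<in> X"
    and lam: "0 < lam" and \<alpha>: "0 < \<alpha>" "\<alpha> \<le> 1" and iid: "iid_sample M P0 n S"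
  interpret dro_setting P0 X R B G loss dl by (rule dro)
  have "vec_variance M (\<lambda>\<omega>. batch_gradient (psi_klcvar \<alpha>) lam n loss dl x (\<lambda>i. S i \<omega>))
      \<le> 8 * G\<^sup>2 * (1 / \<alpha> / real n)"
  proof (rule variance_batch_gradient_le[OF weight_penalty_klcvar[OF n lam \<alpha>] x iid])
    interpret weight_penalty "psi_klcvar \<alpha>" "\<lambda>t. t * ln t - t + 1" "1 / \<alpha>" lam n
      by (rule weight_penalty_klcvar[OF n lam \<alpha>])
    \<comment> \<open>The weights sum to one and each is at most \<open>1 / \<alpha> / real n\<close>.\<close>
    show "(\<Sum>i<n. (worst_weights (psi_klcvar \<alpha>) lam n loss x s i)\<^sup>2) \<le> 1 / \<alpha> / real n" for s
      using maximal_weights sum_squares_feasible_le by (simp add: worst_weights_eq maximal_def)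
  qed
  also have "\<dots> = 8 * (G\<^sup>2 / (\<alpha> * real n))" by (simp add: field_simps)
  also have "\<dots> \<le> 16 * (G\<^sup>2 / (\<alpha> * real n))"
    using \<alpha> by (intro mult_right_mono) auto
  finally show "vec_variance M (\<lambda>\<omega>. batch_gradient (psi_klcvar \<alpha>) lam n loss dl x (\<lambda>i. S i \<omega>))
      \<le> 16 * (G\<^sup>2 / (\<alpha> * real n))" .
  have "vec_variance M (\<lambda>\<omega>. batch_gradient psi_chi2 lam n loss dl x (\<lambda>i. S i \<omega>))
      \<le> 8 * G\<^sup>2 * ((1 + 2 * B / lam) / real n)"
    by (intro variance_batch_gradient_le[OF weight_penalty_chi2[OF n lam] x iid]
              sum_squares_chi2_le n lam loss_range x) (auto simp: space_PiM)
  \<comment> \<open>The factor \<open>2\<close> in front of \<open>B / lam\<close> is what raises the common constant from \<open>8\<close> to \<open>16\<close>.\<close>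
  also have "\<dots> \<le> 8 * G\<^sup>2 * (2 * (1 + B / lam) / real n)"
    using lam by (intro mult_left_mono divide_right_mono) auto
  finally show "vec_variance M (\<lambda>\<omega>. batch_gradient psi_chi2 lam n loss dl x (\<lambda>i. S i \<omega>))
      \<le> 16 * (G\<^sup>2 * (1 + B / lam) / real n)" by (simp add: algebra_simps)
qed auto

end
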